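(* Let $G(p)$ be a bar framework on $n$ vertices in $\mathbb{R}^r$ such that the graph $G$ is chordal, the configuration $p=(p^1,\ldots,p^n)$ is in general position in $\mathbb{R}^r$, and the vertices are labelled so that $1,2,\ldots,n$ is a perfect elimination ordering of $G$. If $G(p)$ admits a stress matrix $S$ of rank $n-r-1$ with generic rank profile, then $G(p)$ admits a positive semidefinite stress matrix $S'$ of rank $n-r-1$.
   Context: A bar framework $G(p)$ in $\mathbb{R}^r$ on $n$ vertices is a connected simple graph $G$ with vertex set $\{1,\ldots,n\}$ and edge set $E(G)$, together with a configuration $p=(p^1,\ldots,p^n)$ of points in $\mathbb{R}^r$ that affinely span $\mathbb{R}^r$. General position: every $r+1$ of the points $p^1,\ldots,p^n$ are affinely independent. Chordal: every cycle of $G$ of length at least $4$ has a chord (an edge joining two non-consecutive vertices of the cycle). Perfect elimination ordering: $1,2,\ldots,n$ is a perfect elimination ordering of $G$ if for each $i=1,\ldots,n-1$, vertex $i$ is simplicial in the subgraph of $G$ induced by $\{i,i+1,\ldots,n\}$, i.e. the set of neighbours of $i$ in that subgraph is a clique (its vertices are pairwise adjacent). Stress matrix: an equilibrium stress of $G(p)$ is a real-valued function $\omega$ on $E(G)$ (with $\omega_{ij}=\omega_{ji}$) such that $\sum_{j:(i,j)\in E(G)}\omega_{ij}(p^i-p^j)=0$ for all $i=1,\ldots,n$. The associated stress matrix is the $n\times n$ symmetric matrix $S=(s_{ij})$ with $s_{ij}=-\omega_{ij}$ if $(i,j)\in E(G)$, $s_{ij}=0$ if $i\neq j$ and $(i,j)\notin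 E(G)$, and $s_{ii}=\sum_{k:(i,k)\in E(G)}\omega_{ik}$. Generic rank profile: a symmetric matrix $A$ of rank $k$ has generic rank profile if its first $k$ leading principal minors are nonzero, where the $m$-th leading principal minor is the determinant of the submatrix formed by the first $m$ rows and columns. *)

theory Defs
  imports
    "HOL-Analysis.Analysis"
    "Graph_Theory.Graph_Theory"
    "Jordan_Normal_Form.DL_Rank"
    "Jordan_Normal_Form.DL_Submatrix"
    "Jordan_Normal_Form.Determinant"
begin

section \<open>Graphs\<close>

text \<open>
  A simple graph is a \<open>pair_graph\<close>: a finite, loop-free, symmetric set \<open>parcs G\<close> of ordered
  pairs, so that an edge between \<open>i\<close> and \<open>j\<close> is present as both \<open>(i, j)\<close> and \<open>(j, i)\<close>.
\<close>

text \<open>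
  A cycle is given by the list of its arcs, so its length is the length of that list. An edge
  between two vertices of the cycle is a chord iff it is not one of the edges of the cycle, in
  either direction.
\<close>
definition chordal :: "'a pair_pre_digraph \<Rightarrow> bool" where
  "chordal G \<longleftrightarrow>
     (\<forall>c. pre_digraph.cycle (with_proj G) c \<and> length c \<ge> 4 \<longrightarrow>
        (\<exists>u \<in> fst ` set c. \<exists>v \<in> fst ` set c.
           (u, v) \<in> parcs G \<and> (u, v) \<notin> set c \<and> (v, u) \<notin> set c))"

definition simplicial :: "('a, 'b) pre_digraph \<Rightarrow> 'a \<Rightarrow> bool" where
  "simplicial H v \<longleftrightarrow>
     (\<forall>j k. v \<rightarrow>\<^bsub>H\<^esub> j \<and> v \<rightarrow>\<^bsub>H\<^esub> k \<and> j \<noteq> k \<longrightarrow> j \<rightarrow>\<^bsub>H\<^esub> k)"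

definition natural_perfect_elimination_ordering :: "nat \<Rightarrow> nat pair_pre_digraph \<Rightarrow> bool" where
  "natural_perfect_elimination_ordering n G \<longleftrightarrow>
     (\<forall>i \<in> {1..<n}. simplicial (with_proj G \<restriction> {i..n}) i)"


section \<open>Bar frameworks\<close>

definition bar_framework ::
    "nat \<Rightarrow> nat pair_pre_digraph \<Rightarrow> (nat \<Rightarrow> real ^ 'r::finite) \<Rightarrow> bool" where
  "bar_framework n G p \<longleftrightarrow>
     pair_graph G \<and> connected (with_proj G) \<and> pverts G = {1..n} \<and>
     affine hull (p ` {1..n}) = UNIV"

text \<open>
  Affine independence is that of an indexed family: coinciding points with different indices are
  dependent, which \<open>affine_dependent\<close>, being a property of sets, does not see.
\<close>
definition general_position :: "nat \<Rightarrow> (nat \<Rightarrow> real ^ 'r::finite) \<Rightarrow> bool" where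
  "general_position n p \<longleftrightarrow>
     (\<forall>I \<subseteq> {1..n}. card I = CARD('r) + 1 \<longrightarrow> inj_on p I \<and> \<not> affine_dependent (p ` I))"


section \<open>Stresses\<close>

text \<open>The values of \<open>\<omega>\<close> at pairs that are not edges play no role.\<close>
definition equilibrium_stress ::
    "nat pair_pre_digraph \<Rightarrow> (nat \<Rightarrow> real ^ 'r::finite) \<Rightarrow> (nat \<Rightarrow> nat \<Rightarrow> real) \<Rightarrow> bool" where
  "equilibrium_stress G p \<omega> \<longleftrightarrow>
     (\<forall>(i, j) \<in> parcs G. \<omega> i j = \<omega> j i) \<and>
     (\<forall>i \<in> pverts G. (\<Sum>j | (i, j) \<in> parcs G. \<omega> i j *\<^sub>R (p i - p j)) = 0)"

text \<open>Vertices are numbered from 1 but matrix indices start at 0, whence the shift by \<open>Suc\<close>.\<close>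
definition stress_mat ::
    "nat \<Rightarrow> nat pair_pre_digraph \<Rightarrow> (nat \<Rightarrow> nat \<Rightarrow> real) \<Rightarrow> real mat" where
  "stress_mat n G \<omega> = mat n n (\<lambda>(i, j).
     if i = j then \<Sum>k | (Suc i, k) \<in> parcs G. \<omega> (Suc i) k
     else if (Suc i, Suc j) \<in> parcs G then - \<omega> (Suc i) (Suc j)
     else 0)"

definition is_stress_matrix ::
    "nat \<Rightarrow> nat pair_pre_digraph \<Rightarrow> (nat \<Rightarrow> real ^ 'r::finite) \<Rightarrow> real mat \<Rightarrow> bool" where
  "is_stress_matrix n G p S \<longleftrightarrow> (\<exists>\<omega>. equilibrium_stress G p \<omega> \<and> S = stress_mat n G \<omega>)"


section \<open>Matrices\<close>

abbreviation mat_rank :: "real mat \<Rightarrow> nat" where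
  "mat_rank A \<equiv> vec_space.rank (dim_row A) A"

definition symmetric_mat :: "real mat \<Rightarrow> bool" where
  "symmetric_mat A \<longleftrightarrow> square_mat A \<and> transpose_mat A = A"

definition generic_rank_profile :: "real mat \<Rightarrow> bool" where
  "generic_rank_profile A \<longleftrightarrow>
     symmetric_mat A \<and>
     (\<forall>m \<in> {1..mat_rank A}. Determinant.det (submatrix A {..<m} {..<m}) \<noteq> 0)"

definition positive_semidefinite :: "real mat \<Rightarrow> bool" where
  "positive_semidefinite A \<longleftrightarrow>
     symmetric_mat A \<and> (\<forall>x \<in> carrier_vec (dim_row A). 0 \<le> scalar_prod x (mult_mat_vec A x))"

end

theory Submission
  imports Defs "Jordan_Normal_Form.DL_Rank_Submatrix"
begin

text \<open>
  Let \<open>k = n - r - 1\<close> be the rank of the given stress matrix \<open>S\<close>. Since the first \<open>k\<close> leading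
  principal minors of \<open>S\<close> are nonzero, symmetric Gaussian elimination can use the first \<open>k\<close>
  diagonal entries as pivots, in their natural order (\<open>pivots_nonzero\<close>). It subtracts from \<open>S\<close>
  the matrices \<open>l\<^sub>i l\<^sub>i\<^sup>T / d\<^sub>i\<close>, where \<open>l\<^sub>i\<close> is the \<open>i\<close>-th pivot column, of which the first
  nonzero entry is the pivot \<open>d\<^sub>i\<close> in position \<open>i\<close>. The pivots may have either sign. The
  matrix sought is \<open>S' = \<Sum>i<k. l\<^sub>i l\<^sub>i\<^sup>T\<close>, in which every \<open>1 / d\<^sub>i\<close> is replaced by \<open>1\<close>; it is
  evidently positive semidefinite.

  \<^item> \<open>S'\<close> respects the edges of the graph. Elimination in a perfect elimination ordering
    creates no fill-in: eliminating vertex \<open>i\<close> changes only entries between later neighbours of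
    \<open>i\<close>, and these are pairwise adjacent (\<open>eliminate_no_fill\<close>). Hence \<open>l\<^sub>i\<close> lives on \<open>i\<close> and its
    later neighbours, a clique, and so does \<open>l\<^sub>i l\<^sub>i\<^sup>T\<close> (\<open>pivot_gram_pattern\<close>).

  \<^item> \<open>S'\<close> satisfies the equilibrium equations. These, and the vanishing of the row sums, say
    that \<open>S q = 0\<close> for \<open>q\<close> the configuration and for \<open>q\<close> constant. The first \<open>k\<close> rows of
    \<open>S q = 0\<close> form a triangular system in the quantities \<open>l\<^sub>i \<cdot> q\<close>, which forces each of them to
    vanish (\<open>pivot_col_annihilates\<close>), and then \<open>S' q = 0\<close>.

  \<^item> \<open>S'\<close> has rank \<open>k\<close>: it is a sum of \<open>k\<close> matrices of rank at most one, and its leading \<open>k\<close> by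
    \<open>k\<close> block is \<open>L L\<^sup>T\<close> with \<open>L\<close> lower triangular and the pivots on the diagonal of \<open>L\<close>
    (\<open>rank_pivot_gram\<close>).

  The matrices are handled as functions of two natural numbers, so that the steps of the
  elimination need no bounds on the indices; index \<open>a\<close> stands for vertex \<open>Suc a\<close>.
\<close>

section \<open>Symmetric Gaussian elimination\<close>

text \<open>
  The eliminated rows and columns are kept and become zero, instead of being deleted as in a
  Schur complement, so that all stages share one index set. At a zero pivot the convention
  \<open>x / 0 = 0\<close> makes the step do nothing.
\<close>
fun eliminate :: "(nat \<Rightarrow> nat \<Rightarrow> real) \<Rightarrow> nat \<Rightarrow> nat \<Rightarrow> nat \<Rightarrow> real" where
  "eliminate A 0 a b = A a b"
| "eliminate A (Suc m) a b =
     eliminate A m a b - eliminate A m a m * eliminate A m m b / eliminate A m m m"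

definition pivot_col :: "(nat \<Rightarrow> nat \<Rightarrow> real) \<Rightarrow> nat \<Rightarrow> nat \<Rightarrow> real" where
  "pivot_col A i a = eliminate A i a i"

definition pivot_gram :: "(nat \<Rightarrow> nat \<Rightarrow> real) \<Rightarrow> nat \<Rightarrow> nat \<Rightarrow> nat \<Rightarrow> real" where
  "pivot_gram A k a b = (\<Sum>i<k. pivot_col A i a * pivot_col A i b)"

lemma eliminate_symmetric:
  assumes "\<And>a b. A a b = A b a"
  shows "eliminate A m a b = eliminate A m b a"
proof (induction m arbitrary: a b)
  case 0
  then show ?case by (simp add: assms)
next
  case (Suc m)
  show ?case
    unfolding eliminate.simps Suc.IH[of a b] Suc.IH[of a m] Suc.IH[of m b]
    by (simp only: mult.commute)
qed

text \<open>
  Telescoping: every step subtracts the outer product of its pivot column with itself, divided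
  by the pivot. The convention for division makes this true even when a pivot vanishes.
\<close>
lemma eliminate_decomposition:
  assumes "\<And>a b. A a b = A b a"
  shows "A a b =
    (\<Sum>i<m. pivot_col A i a * pivot_col A i b / pivot_col A i i) + eliminate A m a b"
proof (induction m)
  case (Suc m)
  have "pivot_col A m b = eliminate A m m b"
    unfolding pivot_col_def using assms by (rule eliminate_symmetric)
  then have "eliminate A m a b
      = pivot_col A m a * pivot_col A m b / pivot_col A m m + eliminate A (Suc m) a b"
    by (simp add: pivot_col_def)
  with Suc.IH show ?case
    unfolding sum.lessThan_Suc by linarith
qed simp

text \<open>
  A step with nonzero pivot \<open>m\<close> clears row and column \<open>m\<close>. It leaves earlier zero rows and
  columns alone, because the correction has a factor from the same row and one from the same
  column.
\<close>
lemma eliminate_eq_0: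
  assumes "\<And>i. i < m \<Longrightarrow> pivot_col A i i \<noteq> 0"
    and "a < m \<or> b < m"
  shows "eliminate A m a b = 0"
  using assms
proof (induction m arbitrary: a b)
  case (Suc m)
  have pivot: "eliminate A m m m \<noteq> 0"
    using Suc.prems(1)[of m] by (simp add: pivot_col_def)
  have IH: "eliminate A m a b = 0" if "a < m \<or> b < m" for a b
    using Suc.IH[of a b] Suc.prems(1) that by auto
  consider "a < m" | "b < m" | "a = m" | "b = m"
    using Suc.prems(2) by linarith
  then show ?case
    using IH[of a m] IH[of m b] IH[of a b] pivot by cases simp_all
qed simp

lemma pivot_col_lower:
  assumes "\<And>i. i < k \<Longrightarrow> pivot_col A i i \<noteq> 0" and "i < k" and "a < i"
  shows "pivot_col A i a = 0"
  unfolding pivot_col_def using assms by (intro eliminate_eq_0) auto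

text \<open>
  This bound serves twice: to see that a vanishing pivot makes a leading block singular, and to
  bound the rank of the new stress matrix from above.
\<close>
lemma rank_sum_of_products_le:
  "mat_rank (mat N nc (\<lambda>(a, b). \<Sum>i<m. f i a * g i b)) \<le> m"
proof (induction m)
  case 0
  have "mat N nc (\<lambda>(a, b). \<Sum>i<(0::nat). f i a * g i b) = 0\<^sub>m N nc"
    by (intro eq_matI) auto
  then show ?case unfolding \<open>_ = 0\<^sub>m N nc\<close> by (simp add: vec_space.rank_0I)
next
  case (Suc m)
  let ?X = "mat N nc (\<lambda>(a, b). \<Sum>i<m. f i a * g i b)"
  let ?Y = "mat N nc (\<lambda>(a, b). f m a * g m b)"
  have eq: "mat N nc (\<lambda>(a, b). \<Sum>i<Suc m. f i a * g i b) = ?X + ?Y"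
    by (intro eq_matI) auto
  have "vec_space.rank N (?X + ?Y) \<le> vec_space.rank N ?X + vec_space.rank N ?Y"
    by (rule vec_space.rank_subadditive[of _ _ nc]) auto
  moreover have "vec_space.rank N ?Y \<le> 1"
    by (rule vec_space.rank_le_1_product_entries[of _ _ nc "f m" "g m"]) auto
  ultimately show ?case
    unfolding eq using Suc.IH by simp
qed

text \<open>
  If the pivots before \<open>m\<close> are nonzero and pivot \<open>m\<close> vanishes, then after \<open>m\<close> steps nothing is
  left of the leading block of size \<open>m + 1\<close>: the rows and columns of index less than \<open>m\<close> are
  cleared, and the only other entry is the pivot. The block is therefore a sum of \<open>m\<close> outer products, of rank at
  most \<open>m\<close>, and its determinant is zero.
\<close>
lemma pivots_nonzero:
  assumes sym: "\<And>a b. A a b = A b a"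
    and minors: "\<And>m. m \<in> {1..k} \<Longrightarrow> Determinant.det (mat m m (\<lambda>(a, b). A a b)) \<noteq> 0"
    and "m < k"
  shows "pivot_col A m m \<noteq> 0"
  using \<open>m < k\<close>
proof (induction m rule: less_induct)
  case (less m)
  have earlier: "pivot_col A i i \<noteq> 0" if "i < m" for i
    using less that by simp
  show ?case
  proof
    assume zero: "pivot_col A m m = 0"
    let ?B = "mat (Suc m) (Suc m) (\<lambda>(a, b). A a b)"
    have "A a b = (\<Sum>i<m. pivot_col A i a * (pivot_col A i b / pivot_col A i i))"
      if "a < Suc m" "b < Suc m" for a b
    proof -
      have "eliminate A m a b = 0"
      proof (cases "a = m \<and> b = m")
        case True
        then show ?thesis using zero by (simp add: pivot_col_def)
      next
        case False
        then show ?thesis using that by (intro eliminate_eq_0 earlier) auto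
      qed
      then show ?thesis
        using eliminate_decomposition[of A a b m] sym by simp
    qed
    then have B: "?B = mat (Suc m) (Suc m)
        (\<lambda>(a, b). \<Sum>i<m. pivot_col A i a * (pivot_col A i b / pivot_col A i i))"
      by (intro eq_matI) auto
    have "mat_rank ?B \<le> m"
      unfolding B by (rule rank_sum_of_products_le)
    moreover have "Determinant.det ?B \<noteq> 0"
      using minors[of "Suc m"] less.prems by simp
    then have "mat_rank ?B = Suc m"
      using vec_space.low_rank_det_zero[of ?B "Suc m"] by simp
    ultimately show False by simp
  qed
qed

text \<open>
  The predicate \<open>adj\<close> says where off-diagonal entries may be nonzero. Entry \<open>(a, b)\<close> can become
  nonzero in step \<open>m\<close> only if \<open>(a, m)\<close> and \<open>(m, b)\<close> were nonzero, so that \<open>a\<close> and \<open>b\<close> are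
  neighbours of \<open>m\<close>. After the step it can be nonzero only if both lie after \<open>m\<close>, and then the
  clique condition at \<open>m\<close> makes them adjacent.
\<close>
lemma eliminate_no_fill:
  assumes pivots: "\<And>i. i < k \<Longrightarrow> pivot_col A i i \<noteq> 0"
    and simplicial: "\<And>i a b. i < k \<Longrightarrow> i < a \<Longrightarrow> i < b \<Longrightarrow> a \<noteq> b \<Longrightarrow>
      adj a i \<Longrightarrow> adj i b \<Longrightarrow> adj a b"
    and pattern: "\<And>a b. a \<noteq> b \<Longrightarrow> A a b \<noteq> 0 \<Longrightarrow> adj a b"
    and "m \<le> k" and "a \<noteq> b" and "eliminate A m a b \<noteq> 0"
  shows "adj a b"
  using assms(4-)
proof (induction m arbitrary: a b)
  case 0
  then show ?case by (simp add: pattern)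
next
  case (Suc m)
  have zero: "eliminate A (Suc m) a b = 0" if "a < Suc m \<or> b < Suc m" for a b
    using pivots Suc.prems(1) that by (intro eliminate_eq_0) auto
  then have "m < a" "m < b"
    using Suc.prems(3) not_less_eq by blast+
  show ?case
  proof (cases "eliminate A m a b = 0")
    case False
    then show ?thesis using Suc by simp
  next
    case True
    then have "eliminate A m a m \<noteq> 0" "eliminate A m m b \<noteq> 0"
      using Suc.prems(3) by auto
    then have "adj a m" "adj m b"
      using Suc.IH Suc.prems(1) \<open>m < a\<close> \<open>m < b\<close> by auto
    then show ?thesis
      using simplicial[of m a b] Suc.prems \<open>m < a\<close> \<open>m < b\<close> by auto
  qed
qed

section \<open>The Gram matrix of the pivot columns\<close>

lemma pivot_gram_symmetric: "pivot_gram A k a b = pivot_gram A k b a"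
  by (simp add: pivot_gram_def mult.commute)

text \<open>
  By the absence of fill-in, pivot column \<open>i\<close> is supported on \<open>i\<close> and its later neighbours.
  These form a clique, so the outer product of the column with itself has its off-diagonal
  entries at adjacent pairs.
\<close>
lemma pivot_gram_pattern:
  assumes sym: "\<And>a b. A a b = A b a"
    and pivots: "\<And>i. i < k \<Longrightarrow> pivot_col A i i \<noteq> 0"
    and simplicial: "\<And>i a b. i < k \<Longrightarrow> i < a \<Longrightarrow> i < b \<Longrightarrow> a \<noteq> b \<Longrightarrow>
      adj a i \<Longrightarrow> adj i b \<Longrightarrow> adj a b"
    and pattern: "\<And>a b. a \<noteq> b \<Longrightarrow> A a b \<noteq> 0 \<Longrightarrow> adj a b"
    and "a \<noteq> b" and "pivot_gram A k a b \<noteq> 0"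
  shows "adj a b"
proof -
  obtain i where i: "i < k" "pivot_col A i a \<noteq> 0" "pivot_col A i b \<noteq> 0"
    using assms(6) unfolding pivot_gram_def
    by (metis (no_types, lifting) lessThan_iff mult_eq_0_iff sum.neutral)
  have no_fill: "adj u v" if "u \<noteq> v" "eliminate A i u v \<noteq> 0" for u v
    by (rule eliminate_no_fill[of k A adj i])
      (use pivots simplicial pattern i(1) that in auto)
  have "\<not> a < i" "\<not> b < i"
    using i pivot_col_lower[of k A i] pivots by auto
  moreover have "adj a i" if "a \<noteq> i"
    using no_fill[of a i] i(2) that by (simp add: pivot_col_def)
  moreover have "adj i b" if "b \<noteq> i"
    using no_fill[of i b] i(3) that eliminate_symmetric[of A i b i] sym by (simp add: pivot_col_def)
  ultimately have ia: "a = i \<or> i < a \<and> adj a i" and ib: "b = i \<or> i < b \<and> adj i b"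
    by (meson linorder_neqE_nat)+
  show ?thesis
    using ia ib simplicial[of i a b] i(1) \<open>a \<noteq> b\<close> by auto
qed

text \<open>
  Write \<open>z i\<close> for the pairing of pivot column \<open>i\<close> with \<open>q\<close>. Row \<open>a\<close> of \<open>A\<close> is unaffected by
  what remains after \<open>k\<close> steps, so it expresses \<open>A q = 0\<close> as a linear relation between the
  \<open>z i\<close>. As column \<open>i\<close> vanishes above position \<open>i\<close>, only \<open>z i\<close> with \<open>i \<le> a\<close> occur, and \<open>z a\<close>
  has coefficient one: forward substitution gives zero throughout. The values of \<open>q\<close> are
  vectors so that a configuration of points can be treated at once.
\<close>
lemma pivot_col_annihilates:
  fixes q :: "nat \<Rightarrow> 'v::real_vector"
  assumes sym: "\<And>a b. A a b = A b a"
    and pivots: "\<And>i. i < k \<Longrightarrow> pivot_col A i i \<noteq> 0"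
    and ann: "\<And>a. a < k \<Longrightarrow> (\<Sum>b<n. A a b *\<^sub>R q b) = 0"
    and "i < k"
  shows "(\<Sum>b<n. pivot_col A i b *\<^sub>R q b) = 0"
  using \<open>i < k\<close>
proof (induction i rule: less_induct)
  case (less a)
  define z where "z i = (\<Sum>b<n. pivot_col A i b *\<^sub>R q b)" for i
  have "eliminate A k a b = 0" for b
    using pivots less.prems by (intro eliminate_eq_0) auto
  then have A: "A a b = (\<Sum>i<k. pivot_col A i a / pivot_col A i i * pivot_col A i b)" for b
    using eliminate_decomposition[of A a b k] sym by simp
  have "0 = (\<Sum>b<n. A a b *\<^sub>R q b)"
    using ann less.prems by simp
  also have "\<dots> = (\<Sum>b<n. \<Sum>i<k. (pivot_col A i a / pivot_col A i i) *\<^sub>R pivot_col A i b *\<^sub>R q b)"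
    unfolding A by (simp add: scaleR_sum_left)
  also have "\<dots> = (\<Sum>i<k. (pivot_col A i a / pivot_col A i i) *\<^sub>R z i)"
    by (subst sum.swap) (simp add: z_def scaleR_sum_right)
  also have "\<dots> = (\<Sum>i\<in>{a}. (pivot_col A i a / pivot_col A i i) *\<^sub>R z i)"
  proof (rule sum.mono_neutral_right)
    show "\<forall>i\<in>{..<k} - {a}. (pivot_col A i a / pivot_col A i i) *\<^sub>R z i = 0"
    proof
      fix i assume i: "i \<in> {..<k} - {a}"
      show "(pivot_col A i a / pivot_col A i i) *\<^sub>R z i = 0"
      proof (cases "i < a")
        case True
        then show ?thesis using less.IH[of i] i by (simp add: z_def)
      next
        case False
        then show ?thesis using pivot_col_lower[of k A i a] pivots i by simp
      qed
    qed
  qed (use less.prems in auto)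
  also have "\<dots> = z a"
    using pivots[OF less.prems] by simp
  finally show ?case
    unfolding z_def ..
qed

lemma pivot_gram_annihilates:
  fixes q :: "nat \<Rightarrow> 'v::real_vector"
  assumes "\<And>a b. A a b = A b a"
    and "\<And>i. i < k \<Longrightarrow> pivot_col A i i \<noteq> 0"
    and "\<And>a. a < k \<Longrightarrow> (\<Sum>b<n. A a b *\<^sub>R q b) = 0"
  shows "(\<Sum>b<n. pivot_gram A k a b *\<^sub>R q b) = 0"
proof -
  have "(\<Sum>b<n. pivot_gram A k a b *\<^sub>R q b)
      = (\<Sum>b<n. \<Sum>i<k. pivot_col A i a *\<^sub>R pivot_col A i b *\<^sub>R q b)"
    by (simp add: pivot_gram_def scaleR_sum_left)
  also have "\<dots> = (\<Sum>i<k. pivot_col A i a *\<^sub>R (\<Sum>b<n. pivot_col A i b *\<^sub>R q b))"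
    by (subst sum.swap) (simp add: scaleR_sum_right)
  also have "\<dots> = 0"
    using pivot_col_annihilates[OF assms] by simp
  finally show ?thesis .
qed

lemma submatrix_initial_mat:
  assumes "m \<le> n"
  shows "submatrix (mat n n (\<lambda>(a, b). A a b)) {..<m} {..<m} = mat m m (\<lambda>(a, b). A a b)"
proof -
  have "{i. i < n \<and> i \<in> {..<m}} = {..<m}"
    using assms by auto
  then have card: "card {i. i < n \<and> i \<in> {..<m}} = m"
    by simp
  have pick: "pick {..<m} i = i" if "i < m" for i
  proof -
    have "{a \<in> {..<m}. a < i} = {..<i}" using that by auto
    then show ?thesis using pick_card_in_set[of i "{..<m}"] that by simp
  qed
  show ?thesis
    unfolding submatrix_def dim_row_mat dim_col_mat card
    by (intro eq_matI) (use assms in \<open>simp_all add: pick\<close>)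
qed

text \<open>
  The lower bound comes from the leading minor of size \<open>k\<close>, which is the square of the product
  of the pivots.
\<close>
lemma rank_pivot_gram:
  assumes pivots: "\<And>i. i < k \<Longrightarrow> pivot_col A i i \<noteq> 0" and "k \<le> n"
  shows "mat_rank (mat n n (\<lambda>(a, b). pivot_gram A k a b)) = k"
proof (rule antisym)
  let ?S = "mat n n (\<lambda>(a, b). pivot_gram A k a b)"
  show "mat_rank ?S \<le> k"
    unfolding pivot_gram_def by (rule rank_sum_of_products_le)
  define L where "L = mat k k (\<lambda>(a, i). pivot_col A i a)"
  have L: "L \<in> carrier_mat k k" by (simp add: L_def)
  have "Determinant.det L = prod_list (diag_mat L)"
    by (rule det_lower_triangular[OF _ L]) (use pivots pivot_col_lower[of k A] in \<open>simp add: L_def\<close>)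
  also have "\<dots> \<noteq> 0"
    using pivots by (auto simp: L_def diag_mat_def prod_list_zero_iff)
  finally have "Determinant.det L \<noteq> 0" .
  have "submatrix ?S {..<k} {..<k} = L * transpose_mat L"
    unfolding submatrix_initial_mat[OF \<open>k \<le> n\<close>]
    by (intro eq_matI)
      (auto simp: L_def pivot_gram_def scalar_prod_def lessThan_atLeast0)
  then have "Determinant.det (submatrix ?S {..<k} {..<k}) = Determinant.det L * Determinant.det L"
    using det_mult[OF L, of "transpose_mat L"] det_transpose[OF L] L by simp
  then have "Determinant.det (submatrix ?S {..<k} {..<k}) \<noteq> 0"
    using \<open>Determinant.det L \<noteq> 0\<close> by simp
  moreover have "{j. j < n \<and> j \<in> {..<k}} = {..<k}"
    using \<open>k \<le> n\<close> by auto
  ultimately show "k \<le> mat_rank ?S"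
    using vec_space.rank_gt_minor[of ?S n n "{..<k}" "{..<k}"]
    by (simp add: dim_submatrix)
qed

text \<open>The quadratic form is a sum of squares, one for each pivot column.\<close>
lemma positive_semidefinite_pivot_gram:
  "positive_semidefinite (mat n n (\<lambda>(a, b). pivot_gram A k a b))"
  (is "positive_semidefinite ?S")
  unfolding positive_semidefinite_def
proof (intro conjI ballI)
  show "symmetric_mat ?S"
    unfolding symmetric_mat_def
    by (auto intro!: eq_matI pivot_gram_symmetric)
  fix x :: "real Matrix.vec" assume "x \<in> carrier_vec (dim_row ?S)"
  then have x: "dim_vec x = n" by simp
  let ?x = "vec_index x"
  have "scalar_prod x (mult_mat_vec ?S x)
      = (\<Sum>a<n. ?x a * (\<Sum>b<n. (\<Sum>i<k. pivot_col A i a * pivot_col A i b) * ?x b))"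
    by (auto simp: scalar_prod_def x pivot_gram_def lessThan_atLeast0 intro!: sum.cong)
  also have "\<dots> = (\<Sum>a<n. \<Sum>b<n. \<Sum>i<k. (pivot_col A i a * ?x a) * (pivot_col A i b * ?x b))"
    by (simp add: sum_distrib_left sum_distrib_right mult_ac)
  also have "\<dots> = (\<Sum>a<n. \<Sum>i<k. \<Sum>b<n. (pivot_col A i a * ?x a) * (pivot_col A i b * ?x b))"
    by (intro sum.cong refl sum.swap)
  also have "\<dots> = (\<Sum>i<k. \<Sum>a<n. \<Sum>b<n. (pivot_col A i a * ?x a) * (pivot_col A i b * ?x b))"
    by (rule sum.swap)
  also have "\<dots> = (\<Sum>i<k. (\<Sum>a<n. pivot_col A i a * ?x a)\<^sup>2)"
    by (simp add: power2_eq_square sum_product)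
  finally show "0 \<le> scalar_prod x (mult_mat_vec ?S x)"
    by (simp add: sum_nonneg)
qed

section \<open>Stress matrices as weighted Laplacians\<close>

text \<open>
  The entries of \<open>stress_mat\<close> without its bounds, as an input to the elimination.
\<close>
definition stress_entry ::
    "nat pair_pre_digraph \<Rightarrow> (nat \<Rightarrow> nat \<Rightarrow> real) \<Rightarrow> nat \<Rightarrow> nat \<Rightarrow> real" where
  "stress_entry G \<omega> a b =
     (if a = b then \<Sum>k | (Suc a, k) \<in> parcs G. \<omega> (Suc a) k
      else if (Suc a, Suc b) \<in> parcs G then - \<omega> (Suc a) (Suc b)
      else 0)"

lemma stress_mat_entries: "stress_mat n G \<omega> = mat n n (\<lambda>(a, b). stress_entry G \<omega> a b)"
  unfolding stress_mat_def stress_entry_def ..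

lemma sum_neighbours:
  fixes g :: "nat \<Rightarrow> 'v::comm_monoid_add"
  assumes "pair_graph G" and "pverts G = {1..n}"
  shows "(\<Sum>j | (i, j) \<in> parcs G. g j) = (\<Sum>b<n. if (i, Suc b) \<in> parcs G then g (Suc b) else 0)"
proof -
  interpret pair_graph G by fact
  have img: "{j. (i, j) \<in> parcs G} = Suc ` {b \<in> {..<n}. (i, Suc b) \<in> parcs G}"
  proof -
    have "\<exists>b<n. j = Suc b" if "(i, j) \<in> parcs G" for j
      using in_arcsD2[OF that] assms(2) by (cases j) auto
    then show ?thesis by auto
  qed
  show ?thesis
    unfolding img by (simp add: sum.reindex flip: sum.inter_filter)
qed

text \<open>
  A stress matrix acts as a weighted Laplacian. For \<open>q = p\<close> this makes the equilibrium
  condition a statement about rows of the matrix; for constant \<open>q\<close> it says that the row sums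
  vanish.
\<close>
lemma stress_entry_row:
  fixes q :: "nat \<Rightarrow> 'v::real_vector"
  assumes G: "pair_graph G" "pverts G = {1..n}" and "a < n"
  shows "(\<Sum>b<n. stress_entry G \<omega> a b *\<^sub>R q (Suc b)) =
    (\<Sum>j | (Suc a, j) \<in> parcs G. \<omega> (Suc a) j *\<^sub>R (q (Suc a) - q j))"
proof -
  interpret pair_graph G by fact
  have noloop: "(Suc a, Suc a) \<notin> parcs G"
    using pair_no_loops by fastforce
  define D where "D = (\<Sum>j | (Suc a, j) \<in> parcs G. \<omega> (Suc a) j)"
  have "(\<Sum>b<n. stress_entry G \<omega> a b *\<^sub>R q (Suc b))
      = (\<Sum>b<n. (if b = a then D *\<^sub>R q (Suc a) else 0)
            - (if (Suc a, Suc b) \<in> parcs G then \<omega> (Suc a) (Suc b) *\<^sub>R q (Suc b) else 0))"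
    by (intro sum.cong) (use noloop in \<open>auto simp: stress_entry_def D_def\<close>)
  also have "\<dots> = D *\<^sub>R q (Suc a) - (\<Sum>j | (Suc a, j) \<in> parcs G. \<omega> (Suc a) j *\<^sub>R q j)"
    using \<open>a < n\<close> by (simp add: sum_subtractf sum_neighbours[OF G])
  also have "\<dots> = (\<Sum>j | (Suc a, j) \<in> parcs G. \<omega> (Suc a) j *\<^sub>R (q (Suc a) - q j))"
    by (simp add: D_def scaleR_sum_left sum_subtractf scaleR_diff_right)
  finally show ?thesis .
qed

lemma stress_entry_symmetric:
  assumes "pair_graph G" and "equilibrium_stress G p \<omega>"
  shows "stress_entry G \<omega> a b = stress_entry G \<omega> b a"
proof -
  interpret pair_graph G by fact
  show ?thesis
    using assms(2) pair_sym_arcs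
    by (auto simp: stress_entry_def equilibrium_stress_def symmetric_def dest: symD)
qed

text \<open>
  The stress is read off the off-diagonal entries; the vanishing row sums then force the
  diagonal to be the one that a stress matrix must have.
\<close>
lemma is_stress_matrixI:
  assumes G: "pair_graph G" "pverts G = {1..n}"
    and sym: "\<And>a b. T a b = T b a"
    and pattern: "\<And>a b. a \<noteq> b \<Longrightarrow> T a b \<noteq> 0 \<Longrightarrow> (Suc a, Suc b) \<in> parcs G"
    and sums: "\<And>a. a < n \<Longrightarrow> (\<Sum>b<n. T a b) = 0"
    and equilibrium: "\<And>a. a < n \<Longrightarrow> (\<Sum>b<n. T a b *\<^sub>R p (Suc b)) = 0"
  shows "is_stress_matrix n G p (mat n n (\<lambda>(a, b). T a b))"
proof -
  interpret pair_graph G by fact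
  define \<omega> where "\<omega> i j = - T (i - 1) (j - 1)" for i j
  have entry: "stress_entry G \<omega> a b = T a b" if "a < n" for a b
  proof (cases "a = b")
    case True
    have noloop: "(Suc a, Suc a) \<notin> parcs G"
      using pair_no_loops by fastforce
    have "stress_entry G \<omega> a a = (\<Sum>b<n. if (Suc a, Suc b) \<in> parcs G then - T a b else 0)"
      by (simp add: stress_entry_def sum_neighbours[OF G] \<omega>_def cong: if_cong)
    also have "\<dots> = (\<Sum>b\<in>{..<n} - {a}. - T a b)"
    proof (rule sum.mono_neutral_cong)
      show "(if (Suc a, Suc b) \<in> parcs G then - T a b else 0) = - T a b"
        if "b \<in> {..<n} \<inter> ({..<n} - {a})" for b
        using pattern[of a b] that by (cases "T a b = 0") auto
    qed (use noloop in auto)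
    also have "\<dots> = T a a - (\<Sum>b<n. T a b)"
      using that by (simp add: sum_negf sum_diff1)
    finally show ?thesis
      using sums[OF that] True by simp
  next
    case False
    then show ?thesis using pattern[of a b] by (auto simp: stress_entry_def \<omega>_def)
  qed
  have "equilibrium_stress G p \<omega>"
    unfolding equilibrium_stress_def
  proof (intro conjI ballI)
    show "case x of (i, j) \<Rightarrow> \<omega> i j = \<omega> j i" for x
      using sym by (auto simp: \<omega>_def)
    fix i assume "i \<in> pverts G"
    then obtain a where a: "i = Suc a" "a < n"
      using G(2) by (cases i) auto
    have "(\<Sum>j | (i, j) \<in> parcs G. \<omega> i j *\<^sub>R (p i - p j)) = (\<Sum>b<n. T a b *\<^sub>R p (Suc b))"
      using stress_entry_row[OF G a(2), of \<omega> p] entry[OF a(2)] a(1) by simp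
    then show "(\<Sum>j | (i, j) \<in> parcs G. \<omega> i j *\<^sub>R (p i - p j)) = 0"
      using equilibrium[OF a(2)] by simp
  qed
  moreover have "mat n n (\<lambda>(a, b). T a b) = stress_mat n G \<omega>"
    unfolding stress_mat_entries by (intro eq_matI) (auto simp: entry)
  ultimately show ?thesis
    unfolding is_stress_matrix_def by blast
qed

section \<open>Frameworks in a perfect elimination ordering\<close>

text \<open>
  The clique condition at vertex \<open>i\<close> in the form that the elimination uses: with indices from 0
  and with no bound on \<open>i\<close>, since the last vertex has no later neighbours.
\<close>
lemma perfect_elimination_clique:
  assumes "pair_graph G" and "pverts G = {1..n}"
    and "natural_perfect_elimination_ordering n G"
    and "i < a" and "i < b" and "a \<noteq> b"
    and "(Suc a, Suc i) \<in> parcs G" and "(Suc i, Suc b) \<in> parcs G"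
  shows "(Suc a, Suc b) \<in> parcs G"
proof -
  interpret pair_graph G by fact
  have "(Suc i, Suc a) \<in> parcs G"
    using assms(7) pair_sym_arcs by (auto simp: symmetric_def dest: symD)
  have "a < n" "b < n"
    using in_arcsD1[OF assms(7)] in_arcsD2[OF assms(8)] assms(2) by auto
  let ?H = "with_proj G \<restriction> {Suc i..n}"
  have simplicial: "simplicial ?H (Suc i)"
    using assms(3) \<open>i < a\<close> \<open>a < n\<close>
    unfolding natural_perfect_elimination_ordering_def by auto
  have ends: "(u, v) \<in> arcs_ends ?H \<longleftrightarrow>
      (u, v) \<in> parcs G \<and> u \<in> {Suc i..n} \<and> v \<in> {Suc i..n}" for u v
    by (force simp: arcs_ends_conv)
  have "Suc i \<rightarrow>\<^bsub>?H\<^esub> Suc a" "Suc i \<rightarrow>\<^bsub>?H\<^esub> Suc b"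
    unfolding ends using \<open>(Suc i, Suc a) \<in> parcs G\<close> assms(4,5,8) \<open>a < n\<close> \<open>b < n\<close> by simp_all
  then have "Suc a \<rightarrow>\<^bsub>?H\<^esub> Suc b"
    using \<open>a \<noteq> b\<close> simplicial[unfolded simplicial_def, rule_format, of "Suc a" "Suc b"]
    by simp
  then show ?thesis
    unfolding ends by blast
qed

theorem theorem1p4:
  fixes n :: nat
    and G :: "nat pair_pre_digraph"
    and p :: "nat \<Rightarrow> real ^ 'r::finite"
  assumes "bar_framework n G p"
    and "chordal G"
    and "general_position n p"
    and "natural_perfect_elimination_ordering n G"
    and "\<exists>S. is_stress_matrix n G p S \<and> mat_rank S = n - CARD('r) - 1 \<and> generic_rank_profile S"
  shows "\<exists>S'. is_stress_matrix n G p S' \<and> mat_rank S' = n - CARD('r) - 1 \<and>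
           positive_semidefinite S'"
proof -
  define k where "k = n - CARD('r) - 1"
  have G: "pair_graph G" "pverts G = {1..n}"
    using assms(1) by (auto simp: bar_framework_def)
  obtain \<omega> where \<omega>: "equilibrium_stress G p \<omega>"
    and rank: "mat_rank (stress_mat n G \<omega>) = k"
    and profile: "generic_rank_profile (stress_mat n G \<omega>)"
    using assms(5) unfolding is_stress_matrix_def k_def by blast
  define A where "A = stress_entry G \<omega>"
  let ?S' = "mat n n (\<lambda>(a, b). pivot_gram A k a b)"
  have sym: "A a b = A b a" for a b
    unfolding A_def by (rule stress_entry_symmetric[OF G(1) \<omega>])
  have "k \<le> n" by (simp add: k_def)
  have minors: "Determinant.det (mat m m (\<lambda>(a, b). A a b)) \<noteq> 0" if "m \<in> {1..k}" for m
  proof -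
    have "Determinant.det (submatrix (stress_mat n G \<omega>) {..<m} {..<m}) \<noteq> 0"
      using profile that rank unfolding generic_rank_profile_def by simp
    then show ?thesis
      using that \<open>k \<le> n\<close> submatrix_initial_mat[of m n A] by (simp add: stress_mat_entries A_def)
  qed
  have pivots: "pivot_col A i i \<noteq> 0" if "i < k" for i
    using sym minors that by (rule pivots_nonzero)
  have pattern: "(Suc a, Suc b) \<in> parcs G" if "a \<noteq> b" "pivot_gram A k a b \<noteq> 0" for a b
  proof (rule pivot_gram_pattern[of A k "\<lambda>a b. (Suc a, Suc b) \<in> parcs G"])
    show "(Suc a, Suc b) \<in> parcs G" if "a \<noteq> b" "A a b \<noteq> 0" for a b
      using that by (auto simp: A_def stress_entry_def split: if_splits)
    show "(Suc a, Suc b) \<in> parcs G"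
      if "i < a" "i < b" "a \<noteq> b" "(Suc a, Suc i) \<in> parcs G" "(Suc i, Suc b) \<in> parcs G" for i a b
      using perfect_elimination_clique[OF G assms(4) that] .
  qed (use sym pivots that in auto)
  \<comment> \<open>The row sums are the case of the constant function 1, the equilibrium equations that of
    the configuration.\<close>
  have sums: "(\<Sum>b<n. pivot_gram A k a b *\<^sub>R (1::real)) = 0" for a
  proof (rule pivot_gram_annihilates[OF sym pivots])
    show "(\<Sum>b<n. A a b *\<^sub>R (1::real)) = 0" if "a < k" for a
      using stress_entry_row[OF G, of a \<omega> "\<lambda>_. 1::real"] that \<open>k \<le> n\<close> by (simp add: A_def)
  qed
  have equilibrium: "(\<Sum>b<n. pivot_gram A k a b *\<^sub>R p (Suc b)) = 0" for a
  proof (rule pivot_gram_annihilates[OF sym pivots])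
    show "(\<Sum>b<n. A a b *\<^sub>R p (Suc b)) = 0" if "a < k" for a
    proof -
      have "Suc a \<in> pverts G" using that \<open>k \<le> n\<close> G(2) by simp
      then show ?thesis
        using stress_entry_row[OF G, of a \<omega> p] that \<open>k \<le> n\<close> \<omega>
        by (simp add: A_def equilibrium_stress_def)
    qed
  qed
  have "is_stress_matrix n G p ?S'"
    by (rule is_stress_matrixI[OF G pivot_gram_symmetric pattern])
      (use sums equilibrium in auto)
  moreover have "mat_rank ?S' = k"
    using pivots \<open>k \<le> n\<close> by (rule rank_pivot_gram)
  ultimately show ?thesis
    using positive_semidefinite_pivot_gram unfolding k_def by blast
qed

end
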